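(* Let $T$ be a thick tree with loops with vertex set $V$ and sink $s\in V$, let $V_0=V\setminus\{s\}$, let $G$ be its sandpile group, and let $\mathbf e^T\in G$ be the identity element of $G$. Let $\mathbf u\in\mathbb{Z}_{\ge0}^{V_0}$ be any configuration. Then the associated recurrent configuration $\sigma(\mathbf u+\mathbf e^T)$ is given recursively, for $j\in V_0$, by $$\sigma(\mathbf u+\mathbf e^T)_j=\begin{cases} u_j-\lfloor u_j/e_{j,p(j)}\rfloor\, e_{j,p(j)}, & \text{if } j\text{ is a leaf},\\ u_j+\lambda_j e_{j,p(j)}+\sum_{i\succ j}\bigl(u_i-\sigma(\mathbf u+\mathbf e^T)_i\bigr), & \text{otherwise},\end{cases}$$ where $$\lambda_j=\left\lfloor\frac{\deg(j)-u_j-\sum_{i\succ j}\bigl(u_i-\sigma(\mathbf u+\mathbf e^T)_i\bigr)-1}{e_{j,p(j)}}\right\rfloor.$$ Moreover, if $\sigma(\mathbf u)$ is already recurrent, then the same formulas hold with $\sigma(\mathbf u+\mathbf e^T)$ replaced throughout by $\sigma(\mathbf u)$.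
   Context: Graphs are finite, connected, undirected, with multiple edges and loops allowed. For vertices $i,j$, $e_{i,j}$ is the number of edges with endpoint set $\{i,j\}$ (so $e_{i,i}$ is the number of loops at $i$), and $\deg(i)=\sum_{j\in V}e_{i,j}$, so each loop is counted once. A distinguished vertex $s\in V$ is called the sink; $V_0=V\setminus\{s\}$. Thick tree with loops: a graph $T$ such that the simple graph $T'$ obtained by deleting all loops and reducing all nonzero edge multiplicities to $1$ is a tree. A leaf is a vertex $i\ne s$ of degree $1$ in $T'$. For $i,j\in V$, write $i\succeq j$ if $j$ lies on the unique path in $T'$ from $i$ to $s$ (endpoints included), and $i\succ j$ if moreover $i\ne j$. For $j\in V_0$, the parent $p(j)$ is the neighbour of $j$ in $T'$ lying on the path from $j$ to $s$ (i.e. $p(j)$ is adjacent to $j$ and $j\succ p(j)$). Sandpile model: a configuration is a vector $\mathbf u\in\mathbb{Z}_{\ge0}^{V_0}$. A vertex $i\in V_0$ is stable for $\mathbf u$ if $u_i<\deg(i)$, otherwise unstable; $\mathbf u$ is stable if all vertices of $V_0$ are. Toppling an unstable vertex $i$ replaces $u_i$ by $u_i-\deg(i)+e_{i,i}$ and $u_j$ by $u_j+e_{i,j}$ for each $j\in V_0$, $j\ne i$. Repeatedly toppling unstable vertices leads, in finitely many steps, to a stable configuration that is independent of the choices, denoted $\sigma(\mathbf u)$ (the stabilization). Put $\mathbf u\oplus\mathbf v=\sigma(\mathbf u+\mathbf v)$. A configuration $\mathbf u$ is recurrent if for every configuration $\mathbf v$ there is a configuration $\mathbf w$ with $\mathbf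 v\oplus\mathbf w=\mathbf u$. The set $G$ of recurrent configurations is an abelian group under $\oplus$ (known), called the sandpile group.
   Formalization: The leaf formula is asserted only at leaves j without loops; at leaves with loops the second ("otherwise") formula is asserted instead, since the leaf formula fails there (one edge js and one loop at j: the only recurrent value is 1, but the leaf formula gives 0). *)

theory Defs
  imports Complex_Main "HOL-Library.Multiset" "HOL-Algebra.Group"
begin

section \<open>Undirected multigraphs with loops\<close>

text \<open>An edge is represented by its endpoint set, \<open>{i, j}\<close> or, for a loop, \<open>{i}\<close>;
  parallel edges are repeated elements of the multiset.\<close>

record 'v multigraph =
  verts :: "'v set"
  edges :: "'v set multiset"

definition edge_mult :: "'v multigraph \<Rightarrow> 'v \<Rightarrow> 'v \<Rightarrow> nat" where
  "edge_mult T i j = count (edges T) {i, j}"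

definition deg :: "'v multigraph \<Rightarrow> 'v \<Rightarrow> nat" where
  "deg T i = (\<Sum>j\<in>verts T. edge_mult T i j)"

definition adjacent :: "'v multigraph \<Rightarrow> 'v \<Rightarrow> 'v \<Rightarrow> bool" where
  "adjacent T i j \<longleftrightarrow> i \<noteq> j \<and> {i, j} \<in># edges T"

definition is_path :: "'v multigraph \<Rightarrow> 'v \<Rightarrow> 'v list \<Rightarrow> 'v \<Rightarrow> bool" where
  "is_path T i xs j \<longleftrightarrow>
     xs \<noteq> [] \<and> hd xs = i \<and> last xs = j \<and> distinct xs \<and> set xs \<subseteq> verts T \<and>
     successively (adjacent T) xs"

definition connected_graph :: "'v multigraph \<Rightarrow> bool" where
  "connected_graph T \<longleftrightarrow> (\<forall>i\<in>verts T. \<forall>j\<in>verts T. \<exists>xs. is_path T i xs j)"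

definition is_graph :: "'v multigraph \<Rightarrow> bool" where
  "is_graph T \<longleftrightarrow>
     finite (verts T) \<and>
     (\<forall>A\<in>#edges T. \<exists>i\<in>verts T. \<exists>j\<in>verts T. A = {i, j}) \<and>
     connected_graph T"

text \<open>Cycles are listed without repeating the initial vertex. As only cycles of length at least
  3 are considered, \<open>is_tree\<close> is meant to be applied to simple graphs.\<close>

definition is_cycle :: "'v multigraph \<Rightarrow> 'v list \<Rightarrow> bool" where
  "is_cycle T xs \<longleftrightarrow>
     length xs \<ge> 3 \<and> is_path T (hd xs) xs (last xs) \<and> adjacent T (last xs) (hd xs)"

definition is_tree :: "'v multigraph \<Rightarrow> bool" where
  "is_tree T \<longleftrightarrow> is_graph T \<and> (\<nexists>xs. is_cycle T xs)"

text \<open>The graph \<open>T'\<close>: loops are deleted and nonzero multiplicities reduced to 1.\<close>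

definition simplification :: "'v multigraph \<Rightarrow> 'v multigraph" where
  "simplification T =
     \<lparr>verts = verts T, edges = mset_set {A \<in> set_mset (edges T). card A \<noteq> 1}\<rparr>"

definition thick_tree_with_loops :: "'v multigraph \<Rightarrow> bool" where
  "thick_tree_with_loops T \<longleftrightarrow> is_graph T \<and> is_tree (simplification T)"

section \<open>The tree order with respect to a sink\<close>

definition nonsink :: "'v multigraph \<Rightarrow> 'v \<Rightarrow> 'v set" where
  "nonsink T s = verts T - {s}"

definition leaf :: "'v multigraph \<Rightarrow> 'v \<Rightarrow> 'v \<Rightarrow> bool" where
  "leaf T s i \<longleftrightarrow> i \<in> nonsink T s \<and> deg (simplification T) i = 1"

definition path_to_sink :: "'v multigraph \<Rightarrow> 'v \<Rightarrow> 'v \<Rightarrow> 'v list" where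
  "path_to_sink T s i = (THE xs. is_path (simplification T) i xs s)"

definition above_eq :: "'v multigraph \<Rightarrow> 'v \<Rightarrow> 'v \<Rightarrow> 'v \<Rightarrow> bool" where
  "above_eq T s i j \<longleftrightarrow> i \<in> verts T \<and> j \<in> set (path_to_sink T s i)"

definition above :: "'v multigraph \<Rightarrow> 'v \<Rightarrow> 'v \<Rightarrow> 'v \<Rightarrow> bool" where
  "above T s i j \<longleftrightarrow> above_eq T s i j \<and> i \<noteq> j"

definition parent :: "'v multigraph \<Rightarrow> 'v \<Rightarrow> 'v \<Rightarrow> 'v" where
  "parent T s j = (THE k. adjacent (simplification T) j k \<and> above T s j k)"

section \<open>The sandpile model\<close>

text \<open>A vector indexed by the non-sink vertices is a function on the vertex type that vanishes
  outside of them; in particular toppling leaves the entries there unchanged.\<close>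

definition configs :: "'v multigraph \<Rightarrow> 'v \<Rightarrow> ('v \<Rightarrow> nat) set" where
  "configs T s = {u. \<forall>i. i \<notin> nonsink T s \<longrightarrow> u i = 0}"

definition stable_at :: "'v multigraph \<Rightarrow> ('v \<Rightarrow> nat) \<Rightarrow> 'v \<Rightarrow> bool" where
  "stable_at T u i \<longleftrightarrow> u i < deg T i"

definition stable :: "'v multigraph \<Rightarrow> 'v \<Rightarrow> ('v \<Rightarrow> nat) \<Rightarrow> bool" where
  "stable T s u \<longleftrightarrow> (\<forall>i\<in>nonsink T s. stable_at T u i)"

definition topple :: "'v multigraph \<Rightarrow> 'v \<Rightarrow> 'v \<Rightarrow> ('v \<Rightarrow> nat) \<Rightarrow> ('v \<Rightarrow> nat)" where
  "topple T s i u = (\<lambda>j.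
     if j \<notin> nonsink T s then u j
     else if j = i then u i - deg T i + edge_mult T i i
     else u j + edge_mult T i j)"

definition topples_to :: "'v multigraph \<Rightarrow> 'v \<Rightarrow> ('v \<Rightarrow> nat) \<Rightarrow> ('v \<Rightarrow> nat) \<Rightarrow> bool" where
  "topples_to T s u v \<longleftrightarrow> (\<exists>i\<in>nonsink T s. \<not> stable_at T u i \<and> v = topple T s i u)"

definition stabilization :: "'v multigraph \<Rightarrow> 'v \<Rightarrow> ('v \<Rightarrow> nat) \<Rightarrow> ('v \<Rightarrow> nat)" where
  "stabilization T s u = (THE v. (topples_to T s)\<^sup>*\<^sup>* u v \<and> stable T s v)"

definition sandpile_add ::
    "'v multigraph \<Rightarrow> 'v \<Rightarrow> ('v \<Rightarrow> nat) \<Rightarrow> ('v \<Rightarrow> nat) \<Rightarrow> ('v \<Rightarrow> nat)" where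
  "sandpile_add T s u v = stabilization T s (\<lambda>i. u i + v i)"

definition recurrent :: "'v multigraph \<Rightarrow> 'v \<Rightarrow> ('v \<Rightarrow> nat) \<Rightarrow> bool" where
  "recurrent T s u \<longleftrightarrow>
     u \<in> configs T s \<and> (\<forall>v\<in>configs T s. \<exists>w\<in>configs T s. sandpile_add T s v w = u)"

definition sandpile_group :: "'v multigraph \<Rightarrow> 'v \<Rightarrow> ('v \<Rightarrow> nat) monoid" where
  "sandpile_group T s =
     \<lparr>carrier = {u. recurrent T s u},
      mult = sandpile_add T s,
      one = (THE e. recurrent T s e \<and>
               (\<forall>v. recurrent T s v \<longrightarrow> sandpile_add T s e v = v \<and> sandpile_add T s v e = v))\<rparr>"

section \<open>The recursive formulas\<close>

definition excess_above :: "'v multigraph \<Rightarrow> 'v \<Rightarrow> ('v \<Rightarrow> nat) \<Rightarrow> ('v \<Rightarrow> nat) \<Rightarrow> 'v \<Rightarrow> int" where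
  "excess_above T s u w j = (\<Sum>i | above T s i j. int (u i) - int (w i))"

definition lambda_coeff :: "'v multigraph \<Rightarrow> 'v \<Rightarrow> ('v \<Rightarrow> nat) \<Rightarrow> ('v \<Rightarrow> nat) \<Rightarrow> 'v \<Rightarrow> int" where
  "lambda_coeff T s u w j =
     \<lfloor>real_of_int (int (deg T j) - int (u j) - excess_above T s u w j - 1)
        / real (edge_mult T j (parent T s j))\<rfloor>"

text \<open>The simple formula in the first case is valid only at leaves without loops: if \<open>T\<close> has one
  non-sink vertex \<open>j\<close>, one loop at \<open>j\<close> and one edge from \<open>j\<close> to the sink, then \<open>deg T j = 2\<close> and
  the only recurrent configuration has the entry 1 at \<open>j\<close>, whereas the first formula always
  gives 0. At a leaf with loops the general formula applies, with an empty sum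
  \<open>excess_above\<close>; at a leaf without loops the two formulas agree.\<close>

definition recursive_formulas ::
    "'v multigraph \<Rightarrow> 'v \<Rightarrow> ('v \<Rightarrow> nat) \<Rightarrow> ('v \<Rightarrow> nat) \<Rightarrow> bool" where
  "recursive_formulas T s u w \<longleftrightarrow>
     (\<forall>j\<in>nonsink T s.
        int (w j) =
          (if leaf T s j \<and> edge_mult T j j = 0
           then int (u j)
                - \<lfloor>real (u j) / real (edge_mult T j (parent T s j))\<rfloor>
                    * int (edge_mult T j (parent T s j))
           else int (u j)
                + lambda_coeff T s u w j * int (edge_mult T j (parent T s j))
                + excess_above T s u w j))"

end

theory Submission
  imports Defs "HOL-Library.Confluence"
begin

text \<open>If \<open>w\<close> arises from \<open>u\<close> by topplings with toppling vector \<open>x\<close>, summing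
  the Laplacian of \<open>x\<close> over the subtree above \<open>j\<close> leaves only the edges from \<open>j\<close> to its parent
  \<open>p\<close>, so \<open>w j\<close> is known modulo their number \<open>e\<close> from \<open>u\<close> and the values of \<open>w\<close> above \<open>j\<close>.
  If \<open>w\<close> is recurrent, then \<open>deg j - e \<le> w j < deg j\<close>, because otherwise the subtree would carry a
  forbidden subconfiguration; this fixes the residue and gives the formulas. The same bounds show
  that each class modulo the Laplacian lattice contains at most one recurrent configuration. Hence
  stabilizing a large lattice element, which a strictly superharmonic function provides, yields
  the identity of the sandpile group, and adding it does not change the class of \<open>u\<close>.\<close>

section \<open>Paths in trees\<close>

lemma edge_mult_commute: "edge_mult T i j = edge_mult T j i"
  by (simp add: edge_mult_def insert_commute)

lemma adjacent_commute: "adjacent T i j \<longleftrightarrow> adjacent T j i"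
  by (auto simp: adjacent_def insert_commute)

lemma adjacent_iff_edge_mult: "adjacent T i j \<longleftrightarrow> i \<noteq> j \<and> edge_mult T i j > 0"
  by (simp add: adjacent_def edge_mult_def)

lemma adjacent_simplification: "adjacent (simplification T) = adjacent T"
  by (auto simp: fun_eq_iff adjacent_def simplification_def)

lemma edge_mult_simplification:
  "edge_mult (simplification T) i j = of_bool (adjacent T i j)"
  by (auto simp: edge_mult_def simplification_def adjacent_def count_mset_set')

text \<open>Common initial vertices are stripped by induction. Where the paths part, they must meet
  again, as both end in \<open>j\<close>; going to the meeting vertex \<open>z\<close> along one and
  back along the other closes a cycle.\<close>

lemma acyclic_unique_path:
  assumes acyclic: "\<nexists>cs. is_cycle T cs"
    and "is_path T i xs j" and "is_path T i ys j"
  shows "xs = ys"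
  using assms(2,3)
proof (induction xs arbitrary: i ys)
  case Nil
  then show ?case by (simp add: is_path_def)
next
  case (Cons x xs)
  have [simp]: "x = i" using Cons.prems(1) by (simp add: is_path_def)
  obtain ys' where ys: "ys = i # ys'"
    using Cons.prems(2) by (cases ys) (auto simp: is_path_def)
  show ?case
  proof (cases "xs = [] \<or> ys' = []")
    case True
    have "xs = []" "ys' = []"
      using Cons.prems True ys last_in_set[of xs] last_in_set[of ys']
      by (auto simp: is_path_def split: if_splits)
    then show ?thesis using ys by simp
  next
    case False
    then have ne: "xs \<noteq> []" "ys' \<noteq> []" by auto
    have px: "is_path T (hd xs) xs j" and py: "is_path T (hd ys') ys' j"
      and ax: "adjacent T i (hd xs)" and ay: "adjacent T i (hd ys')"
      using Cons.prems ys ne by (auto simp: is_path_def successively_Cons)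
    show ?thesis
    proof (cases "hd xs = hd ys'")
      case True
      then show ?thesis using Cons.IH[OF px] py ys by simp
    next
      case heads: False
      have "\<exists>z\<in>set xs. z \<in> set ys'"
        using px py last_in_set by (metis is_path_def)
      then obtain p z r where xs: "xs = p @ z # r" and z: "z \<in> set ys'"
        and p: "\<forall>y\<in>set p. y \<notin> set ys'"
        by (rule split_list_first_propE)
      obtain q r' where ys': "ys' = q @ z # r'" using z by (metis split_list)
      define cs where "cs = i # p @ z # rev q"
      \<comment> \<open>As the paths part right after \<open>i\<close>, the vertex \<open>z\<close>
        cannot come second on both; this gives \<open>cs\<close> the third vertex that
        \<open>is_cycle\<close> demands.\<close>
      have "p \<noteq> [] \<or> q \<noteq> []" using heads xs ys' by auto
      then have "length cs \<ge> 3" by (cases p; cases q) (auto simp: cs_def)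
      moreover have "distinct cs" "set cs \<subseteq> verts T"
        using Cons.prems p xs ys' ys by (auto simp: cs_def is_path_def)
      moreover have "successively (adjacent T) cs"
      proof -
        have "successively (adjacent T) (i # p @ [z])"
          using Cons.prems(1) xs
          by (auto simp: is_path_def successively_append_iff successively_Cons hd_append
              split: if_splits)
        moreover have "successively (adjacent T) (rev (q @ [z]))"
          using py unfolding successively_rev ys' is_path_def
          by (auto simp: successively_append_iff successively_Cons adjacent_commute
              elim!: successively_mono)
        ultimately show ?thesis
          by (auto simp: cs_def successively_append_iff successively_Cons hd_append
              split: if_splits)
      qed
      moreover have "last cs = hd ys'"
        by (cases q) (auto simp: cs_def ys')
      ultimately have "is_cycle T cs"
        using ay by (auto simp: is_cycle_def is_path_def adjacent_commute cs_def)
      then show ?thesis using acyclic by blast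
    qed
  qed
qed

section \<open>The tree rooted at the sink: parents and subtrees\<close>

locale thick_tree =
  fixes T :: "'v multigraph" and s :: 'v
  assumes thick_tree: "thick_tree_with_loops T"
    and sink: "s \<in> verts T"
begin

abbreviation path :: "'v \<Rightarrow> 'v list" where
  "path \<equiv> path_to_sink T s"

abbreviation par :: "'v \<Rightarrow> 'v" where
  "par \<equiv> parent T s"

definition subtree :: "'v \<Rightarrow> 'v set" where
  "subtree j = {i. above_eq T s i j}"

lemma verts_simplification [simp]: "verts (simplification T) = verts T"
  by (simp add: simplification_def)

lemma finite_verts: "finite (verts T)"
  using thick_tree by (simp add: thick_tree_with_loops_def is_graph_def)

lemma is_path_simplification [simp]: "is_path (simplification T) = is_path T"
  by (simp add: is_path_def adjacent_simplification fun_eq_iff)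

lemma acyclic: "\<nexists>cs. is_cycle T cs"
  using thick_tree
  by (simp add: thick_tree_with_loops_def is_tree_def is_cycle_def adjacent_simplification)

lemma is_path_path:
  assumes "i \<in> verts T"
  shows "is_path T i (path i) s"
proof -
  obtain xs where "is_path T i xs s"
    using thick_tree assms sink
    unfolding thick_tree_with_loops_def is_graph_def connected_graph_def by blast
  then have "\<exists>!xs. is_path T i xs s" using acyclic_unique_path[OF acyclic] by blast
  from theI'[OF this] show ?thesis by (simp add: path_to_sink_def)
qed

lemma path_eqI: "is_path T i xs s \<Longrightarrow> path i = xs"
  using acyclic_unique_path[OF acyclic] is_path_path
  by (metis hd_in_set is_path_def subsetD)

lemma path_sink [simp]: "path s = [s]"
  by (rule path_eqI) (simp add: is_path_def sink)

lemma path_suffix: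
  assumes "i \<in> verts T" and "path i = xs @ k # ys"
  shows "path k = k # ys"
  using is_path_path[OF assms(1)] assms(2)
  by (intro path_eqI) (auto simp: is_path_def successively_append_iff)

text \<open>Putting \<open>i\<close> in front of \<open>path k\<close> gives a path to the sink
  unless \<open>i\<close> already lies on it. In that case \<open>path i\<close> is a suffix of
  \<open>path k\<close> that misses \<open>k\<close>, so \<open>k\<close> can be put in front of
  \<open>path i\<close>. Uniqueness of paths identifies the results.\<close>

lemma adjacent_path_cases:
  assumes "adjacent T i k" and "i \<in> verts T" and "k \<in> verts T"
  shows "path i = i # path k \<or> path k = k # path i"
proof (cases "i \<in> set (path k)")
  case False
  have "is_path T i (i # path k) s"
    using is_path_path[OF assms(3)] assms False
    by (auto simp: is_path_def successively_Cons)
  then show ?thesis using path_eqI by blast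
next
  case True
  then obtain xs ys where k: "path k = xs @ i # ys" by (metis split_list)
  then have i: "path i = i # ys" using path_suffix assms(3) by blast
  have p: "is_path T k (path k) s" by (rule is_path_path[OF assms(3)])
  have "xs \<noteq> []" using k p assms(1) by (auto simp: is_path_def adjacent_def)
  then have "k \<notin> set (path i)" using k i p by (cases xs) (auto simp: is_path_def)
  then have "is_path T k (k # path i) s"
    using is_path_path[OF assms(2)] assms
    by (auto simp: is_path_def successively_Cons adjacent_commute)
  then show ?thesis using path_eqI by blast
qed

lemma nonsink_in_verts: "j \<in> nonsink T s \<Longrightarrow> j \<in> verts T"
  by (simp add: nonsink_def)

lemma finite_nonsink: "finite (nonsink T s)"
  using finite_verts by (simp add: nonsink_def)

lemma path_distinct: "i \<in> verts T \<Longrightarrow> distinct (path i)"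
  using is_path_path by (auto simp: is_path_def)

text \<open>The parent is the second vertex of \<open>path j\<close>. The recursion
  \<open>path_parent\<close> carries the later comparisons of depth and membership in
  subtrees.\<close>

lemma
  assumes "j \<in> nonsink T s"
  shows adjacent_parent: "adjacent T j (par j)"
    and parent_in_verts: "par j \<in> verts T"
    and path_parent: "path j = j # path (par j)"
proof -
  have j: "j \<in> verts T" "j \<noteq> s" using assms by (auto simp: nonsink_def)
  note p = is_path_path[OF j(1)]
  obtain k ks where pj: "path j = j # k # ks"
    using p j by (cases "path j" rule: remdups_adj.cases) (auto simp: is_path_def)
  have k: "adjacent T j k" "k \<in> verts T" "k \<in> set (path j)" "j \<noteq> k"
    using p pj by (auto simp: is_path_def)
  have pk: "path j = j # path k"
    using path_suffix[OF j(1), of "[j]" k ks] pj by simp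
  have "par j = k"
    unfolding parent_def
  proof (rule the_equality)
    show "adjacent (simplification T) j k \<and> above T s j k"
      using k j by (simp add: adjacent_simplification above_def above_eq_def)
  next
    fix l assume "adjacent (simplification T) j l \<and> above T s j l"
    then have l: "adjacent T j l" "l \<in> set (path j)" "l \<noteq> j"
      by (auto simp: adjacent_simplification above_def above_eq_def)
    have lv: "l \<in> verts T" using l p by (auto simp: is_path_def)
    \<comment> \<open>A second candidate \<open>l\<close> either comes second on
      \<open>path j\<close> as well, or \<open>path l\<close> would visit \<open>l\<close>
      twice.\<close>
    from adjacent_path_cases[OF l(1) j(1) lv] show "l = k"
    proof
      assume "path j = j # path l"
      then have "path l = k # ks" using pj by simp
      then show ?thesis using is_path_path[OF lv] by (simp add: is_path_def)
    next
      assume "path l = l # path j"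
      then show ?thesis using path_distinct[OF lv] l by simp
    qed
  qed
  with k pk show "adjacent T j (par j)" "par j \<in> verts T" "path j = j # path (par j)"
    by auto
qed

lemma adjacent_cases:
  assumes "adjacent T i k" and "i \<in> nonsink T s" and "k \<in> verts T"
  obtains "k = par i" | "k \<in> nonsink T s" and "par k = i"
proof -
  have eq: "k = l" if "path k = path l" "k \<in> verts T" "l \<in> verts T" for k l
    using is_path_path that by (metis is_path_def)
  have "path i = i # path k \<or> path k = k # path i"
    using adjacent_path_cases assms nonsink_in_verts by blast
  then show thesis
  proof
    assume "path i = i # path k"
    then show thesis
      using path_parent[OF assms(2)] eq assms parent_in_verts that by auto
  next
    assume k: "path k = k # path i"
    have "path i \<noteq> []" using is_path_path[OF nonsink_in_verts[OF assms(2)]] by (simp add: is_path_def)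
    then have "k \<in> nonsink T s" using assms(3) k by (auto simp: nonsink_def)
    then show thesis
      using path_parent[of k] k eq[of i "par k"] assms parent_in_verts nonsink_in_verts that
      by auto
  qed
qed

lemma edge_mult_parent_pos: "j \<in> nonsink T s \<Longrightarrow> edge_mult T j (par j) > 0"
  using adjacent_parent by (simp add: adjacent_iff_edge_mult)

lemma subtree_iff: "i \<in> subtree j \<longleftrightarrow> i \<in> verts T \<and> j \<in> set (path i)"
  by (simp add: subtree_def above_eq_def)

lemma self_in_subtree: "j \<in> verts T \<Longrightarrow> j \<in> subtree j"
  using is_path_path[of j] hd_in_set[of "path j"] by (simp add: subtree_iff is_path_def)

lemma subtree_subset_nonsink:
  "j \<in> nonsink T s \<Longrightarrow> subtree j \<subseteq> nonsink T s"
  by (auto simp: subtree_iff nonsink_def)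

lemma finite_subtree: "finite (subtree j)"
  by (rule finite_subset[OF _ finite_verts]) (auto simp: subtree_iff)

lemma parent_notin_subtree:
  assumes "j \<in> nonsink T s"
  shows "par j \<notin> subtree j"
  using path_distinct[OF nonsink_in_verts[OF assms]] path_parent[OF assms]
  by (simp add: subtree_iff)

text \<open>A neighbour is the parent or a child. Children of a vertex of the subtree stay inside,
  and so does its parent, unless the vertex is \<open>j\<close> itself. This is what makes sums over
  a subtree collapse to one edge class.\<close>

lemma edge_leaving_subtree:
  assumes "j \<in> nonsink T s" and "i \<in> subtree j" and "k \<in> verts T" and "k \<notin> subtree j"
    and "edge_mult T i k > 0"
  shows "i = j \<and> k = par j"
proof -
  have i: "i \<in> nonsink T s" using assms subtree_subset_nonsink by blast
  have "adjacent T i k" using assms by (auto simp: adjacent_iff_edge_mult)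
  then show ?thesis
    using i assms(3)
  proof (cases rule: adjacent_cases)
    case 1
    then show ?thesis using assms path_parent[OF i] by (auto simp: subtree_iff)
  next
    case 2
    then show ?thesis using assms path_parent[of k] by (auto simp: subtree_iff)
  qed
qed

text \<open>A path from another vertex through \<open>j\<close> enters \<open>j\<close> by
  \<open>last xs\<close> and leaves it by \<open>par j\<close>. These are two distinct neighbours,
  so \<open>j\<close> would have degree at least 2 in the simplification.\<close>

lemma leaf_subtree:
  assumes "leaf T s j"
  shows "subtree j = {j}"
proof (rule ccontr)
  have j: "j \<in> nonsink T s" using assms by (simp add: leaf_def)
  assume "subtree j \<noteq> {j}"
  then obtain i where i: "i \<in> verts T" "j \<in> set (path i)" "i \<noteq> j"
    using self_in_subtree[OF nonsink_in_verts[OF j]] unfolding set_eq_iff subtree_iff by blast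
  obtain xs ys where pi: "path i = xs @ j # ys" using i by (metis split_list)
  note p = is_path_path[OF i(1)]
  have "xs \<noteq> []" using pi i p by (auto simp: is_path_def)
  have ys: "j # ys = j # path (par j)" using path_suffix[OF i(1) pi] path_parent[OF j] by simp
  have "par j \<in> set ys"
    using ys self_in_subtree[OF parent_in_verts[OF j]] by (simp add: subtree_iff)
  moreover have "last xs \<in> set xs" using \<open>xs \<noteq> []\<close> by simp
  ultimately have ne: "last xs \<noteq> par j" using path_distinct[OF i(1)] pi by auto
  have adj: "adjacent T (last xs) j" "last xs \<in> verts T"
    using p \<open>xs \<noteq> []\<close> \<open>last xs \<in> set xs\<close>
    by (auto simp: pi is_path_def successively_append_iff)
  have "deg (simplification T) j = card {k \<in> verts T. adjacent T j k}"
    using finite_verts by (simp add: deg_def edge_mult_simplification Int_def)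
  moreover have "card {last xs, par j} \<le> card {k \<in> verts T. adjacent T j k}"
    using adj adjacent_parent[OF j] parent_in_verts[OF j] finite_verts
    by (intro card_mono) (auto simp: adjacent_commute)
  ultimately show False using ne assms by (simp add: leaf_def)
qed

end

section \<open>Abelian sandpiles\<close>

lemma topple_other: "j \<notin> nonsink T s \<Longrightarrow> topple T s i u j = u j"
  by (simp add: topple_def)

text \<open>Instability makes the truncated subtraction in \<open>topple\<close> exact, so that
  legal topplings become linear over the integers.\<close>

lemma int_topple:
  assumes "j \<in> nonsink T s" and "\<not> stable_at T u i"
  shows "int (topple T s i u j) =
    int (u j) + int (edge_mult T i j) - (if j = i then int (deg T i) else 0)"
  using assms by (auto simp: topple_def stable_at_def)

lemma topple_add:
  assumes "\<not> stable_at T u i"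
  shows "topple T s i (\<lambda>k. u k + w k) = (\<lambda>k. topple T s i u k + w k)"
  using assms by (auto simp: topple_def stable_at_def fun_eq_iff)

lemma topples_to_add:
  assumes "(topples_to T s)\<^sup>*\<^sup>* u v"
  shows "(topples_to T s)\<^sup>*\<^sup>* (\<lambda>i. u i + w i) (\<lambda>i. v i + w i)"
  using assms
proof induction
  case (step v v')
  then obtain i where i: "i \<in> nonsink T s" "\<not> stable_at T v i" "v' = topple T s i v"
    by (auto simp: topples_to_def)
  then have "topples_to T s (\<lambda>i. v i + w i) (\<lambda>i. v' i + w i)"
    using topple_add[OF i(2), of s w] by (auto simp: topples_to_def stable_at_def intro!: bexI[of _ i])
  with step.IH show ?case by simp
qed simp

lemma topple_unstable_at_other:
  assumes "\<not> stable_at T u j" and "i \<noteq> j"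
  shows "\<not> stable_at T (topple T s i u) j"
  using assms by (auto simp: topple_def stable_at_def)

lemma topple_commute:
  assumes "\<not> stable_at T u i" and "\<not> stable_at T u j" and "i \<noteq> j"
  shows "topple T s j (topple T s i u) = topple T s i (topple T s j u)"
  using assms by (auto simp: topple_def stable_at_def fun_eq_iff)

text \<open>Toppling one unstable vertex never makes another one stable, and the two topplings
  commute, so every fork closes in one step on each side.\<close>

lemma confluentp_topples_to: "confluentp (topples_to T s)"
proof (rule strong_confluentp_imp_confluentp, rule strong_confluentpI)
  fix x y z assume "topples_to T s x y" "topples_to T s x z"
  then obtain i j where i: "i \<in> nonsink T s" "\<not> stable_at T x i" "y = topple T s i x"
    and j: "j \<in> nonsink T s" "\<not> stable_at T x j" "z = topple T s j x"
    unfolding topples_to_def by blast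
  show "\<exists>u. (topples_to T s)\<^sup>*\<^sup>* y u \<and> (topples_to T s)\<^sup>=\<^sup>= z u"
  proof (cases "i = j")
    case False
    have "topples_to T s y (topple T s j y)"
      using i j False topple_unstable_at_other unfolding topples_to_def by metis
    moreover have "topples_to T s z (topple T s j y)"
      using i j False topple_unstable_at_other topple_commute unfolding topples_to_def by metis
    ultimately show ?thesis by blast
  qed (use i j in auto)
qed

lemma stable_not_topples_to: "stable T s u \<Longrightarrow> (topples_to T s)\<^sup>*\<^sup>* u v \<Longrightarrow> v = u"
  by (erule converse_rtranclpE) (auto simp: stable_def topples_to_def)

lemma stabilization_eqI:
  assumes "(topples_to T s)\<^sup>*\<^sup>* u v" and "stable T s v"
  shows "stabilization T s u = v"
  unfolding stabilization_def
proof (rule the_equality)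
  fix w assume "(topples_to T s)\<^sup>*\<^sup>* u w \<and> stable T s w"
  then show "w = v"
    using assms confluentpD[OF confluentp_topples_to] stable_not_topples_to by metis
qed (use assms in simp)

lemma topples_to_configs:
  assumes "(topples_to T s)\<^sup>*\<^sup>* u v" and "u \<in> configs T s"
  shows "v \<in> configs T s"
  using assms by induction (auto simp: topples_to_def topple_other configs_def)

section \<open>The Laplacian and equivalence of configurations modulo toppling\<close>

definition laplacian :: "'v multigraph \<Rightarrow> ('v \<Rightarrow> int) \<Rightarrow> 'v \<Rightarrow> int" where
  "laplacian T x j = (\<Sum>k\<in>verts T. int (edge_mult T j k) * (x k - x j))"

text \<open>The vector \<open>x\<close> holds net toppling numbers, possibly negative. It needs no
  normalization at the sink, since \<open>laplacian\<close> depends only on differences and a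
  constant shift of \<open>x\<close> changes nothing.\<close>

definition toppling_equiv :: "'v multigraph \<Rightarrow> 'v \<Rightarrow> ('v \<Rightarrow> nat) \<Rightarrow> ('v \<Rightarrow> nat) \<Rightarrow> bool" where
  "toppling_equiv T s u v \<longleftrightarrow>
     (\<exists>x. \<forall>j\<in>nonsink T s. int (v j) = int (u j) + laplacian T x j)"

lemma laplacian_add: "laplacian T (\<lambda>k. x k + y k) j = laplacian T x j + laplacian T y j"
  by (simp add: laplacian_def sum.distrib[symmetric] algebra_simps)

lemma laplacian_scale: "laplacian T (\<lambda>k. c * x k) j = c * laplacian T x j"
  by (simp add: laplacian_def sum_distrib_left algebra_simps)

lemma laplacian_indicator:
  assumes "finite (verts T)" and "i \<in> verts T"
  shows "laplacian T (\<lambda>k. of_bool (k = i)) j =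
    int (edge_mult T i j) - (if j = i then int (deg T i) else 0)"
proof -
  have "laplacian T (\<lambda>k. of_bool (k = i)) j =
      (\<Sum>k\<in>verts T. int (edge_mult T j k) * of_bool (k = i))
      - (\<Sum>k\<in>verts T. int (edge_mult T j k)) * of_bool (j = i)"
    by (simp add: laplacian_def right_diff_distrib sum_subtractf sum_distrib_right)
  also have "(\<Sum>k\<in>verts T. int (edge_mult T j k) * of_bool (k = i)) = int (edge_mult T j i)"
    using assms by (simp add: of_bool_def if_distrib sum.delta' cong: if_cong)
  finally show ?thesis
    by (auto simp: deg_def edge_mult_commute)
qed

lemma toppling_equiv_refl: "toppling_equiv T s u u"
  unfolding toppling_equiv_def by (rule exI[of _ "\<lambda>_. 0"]) (simp add: laplacian_def)

lemma toppling_equiv_sym: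
  assumes "toppling_equiv T s u v"
  shows "toppling_equiv T s v u"
proof -
  obtain x where "\<forall>j\<in>nonsink T s. int (v j) = int (u j) + laplacian T x j"
    using assms by (auto simp: toppling_equiv_def)
  then show ?thesis
    unfolding toppling_equiv_def
    by (intro exI[of _ "\<lambda>k. (-1) * x k"]) (simp only: laplacian_scale, simp)
qed

lemma toppling_equiv_trans:
  assumes "toppling_equiv T s u v" and "toppling_equiv T s v w"
  shows "toppling_equiv T s u w"
proof -
  obtain x y where "\<forall>j\<in>nonsink T s. int (v j) = int (u j) + laplacian T x j"
    "\<forall>j\<in>nonsink T s. int (w j) = int (v j) + laplacian T y j"
    using assms unfolding toppling_equiv_def by blast
  then show ?thesis
    unfolding toppling_equiv_def
    by (intro exI[of _ "\<lambda>k. x k + y k"]) (simp add: laplacian_add)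
qed

lemma toppling_equiv_add:
  assumes "toppling_equiv T s u v"
  shows "toppling_equiv T s (\<lambda>i. u i + w i) (\<lambda>i. v i + w i)"
  using assms by (fastforce simp: toppling_equiv_def)

lemma topples_to_toppling_equiv:
  assumes "finite (verts T)" and "(topples_to T s)\<^sup>*\<^sup>* u v"
  shows "toppling_equiv T s u v"
  using assms(2)
proof induction
  case (step v v')
  then obtain i where i: "i \<in> nonsink T s" "\<not> stable_at T v i" "v' = topple T s i v"
    by (auto simp: topples_to_def)
  then have "toppling_equiv T s v v'"
    unfolding toppling_equiv_def
    by (intro exI[of _ "\<lambda>k. of_bool (k = i)"])
      (simp add: int_topple laplacian_indicator assms(1) nonsink_def)
  with step.IH show ?case by (rule toppling_equiv_trans)
qed (rule toppling_equiv_refl)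

text \<open>The conclusion says that \<open>v\<close> has no forbidden subconfiguration. Toppling \<open>t \<in> F\<close>
  preserves this because a witness for \<open>F - {t}\<close> receives its edges to \<open>t\<close>.\<close>

lemma topples_to_no_forbidden_subconfig:
  assumes "finite (verts T)" and "(topples_to T s)\<^sup>*\<^sup>* u v"
    and "\<forall>i\<in>nonsink T s. deg T i \<le> u i"
    and "F \<subseteq> nonsink T s" and "F \<noteq> {}"
  shows "\<exists>i\<in>F. (\<Sum>k\<in>F. edge_mult T i k) \<le> v i"
  using assms(2,4,5)
proof (induction arbitrary: F)
  case base
  then obtain i where i: "i \<in> F" by auto
  have "(\<Sum>k\<in>F. edge_mult T i k) \<le> deg T i"
    unfolding deg_def using base assms(1) by (intro sum_mono2) (auto simp: nonsink_def)
  then show ?case using i assms(3) base by (meson order_trans subsetD)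
next
  case (step v v')
  obtain t where t: "t \<in> nonsink T s" "\<not> stable_at T v t" "v' = topple T s t v"
    using step.hyps by (auto simp: topples_to_def)
  have finF: "finite F"
    using step.prems assms(1) by (auto simp: nonsink_def intro: finite_subset)
  have grow: "v' i = v i + edge_mult T i t" if "i \<in> F" "i \<noteq> t" for i
    using that t step.prems by (auto simp: topple_def edge_mult_commute)
  show ?case
  proof (cases "t \<in> F")
    case False
    then show ?thesis
      using step.IH[OF step.prems] grow by (metis trans_le_add1)
  next
    case True
    show ?thesis
    proof (cases "F = {t}")
      case True
      \<comment> \<open>A toppled vertex gets back one grain per loop, and the sum over
        \<open>{t}\<close> counts just these loops.\<close>
      then show ?thesis using t by (simp add: topple_def)
    next
      case False
      then obtain i where i: "i \<in> F - {t}" "(\<Sum>k\<in>F - {t}. edge_mult T i k) \<le> v i"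
        using step.IH[of "F - {t}"] step.prems \<open>t \<in> F\<close> by blast
      have "(\<Sum>k\<in>F. edge_mult T i k) = edge_mult T i t + (\<Sum>k\<in>F - {t}. edge_mult T i k)"
        using finF \<open>t \<in> F\<close> by (rule sum.remove)
      then show ?thesis using i grow by (intro bexI[of _ i]) auto
    qed
  qed
qed

section \<open>Termination of toppling\<close>

context thick_tree
begin

text \<open>The constant \<open>M\<close> exceeds every degree, so the gain across the edge to the parent
  outweighs the losses across all other edges.\<close>

lemma superharmonic_function:
  obtains h :: "'v \<Rightarrow> int"
  where "\<And>j. j \<in> verts T \<Longrightarrow> h j \<ge> 0"
    and "\<And>j. j \<in> nonsink T s \<Longrightarrow> laplacian T h j \<le> -1"
proof
  define M where "M = 1 + (\<Sum>j\<in>verts T. int (deg T j))"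
  define L where "L = card (verts T)"
  define h where "h j = M ^ L - M ^ (L - length (path j))" for j
  have deg_less: "int (deg T j) < M" if "j \<in> verts T" for j
  proof -
    have "int (deg T j) \<le> (\<Sum>j\<in>verts T. int (deg T j))"
      using that finite_verts by (intro member_le_sum) auto
    then show ?thesis by (simp add: M_def)
  qed
  have M: "M \<ge> 1" by (simp add: M_def sum_nonneg)
  then show "h j \<ge> 0" if "j \<in> verts T" for j
    unfolding h_def by (simp add: power_increasing)
  fix j assume j: "j \<in> nonsink T s"
  note jv = nonsink_in_verts[OF j]
  define a where "a = M ^ (L - length (path j))"
  \<comment> \<open>The exponent \<open>L - length (path j)\<close> is therefore not truncated, and
    passing to the parent raises it by exactly one: the power \<open>a\<close> becomes
    \<open>M * a\<close>.\<close>
  have "length (path j) \<le> L"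
    using is_path_path[OF jv] finite_verts
    by (metis L_def card_mono distinct_card is_path_def)
  moreover have "length (path j) = Suc (length (path (par j)))"
    using arg_cong[OF path_parent[OF j], of length] by simp
  ultimately have par: "M ^ (L - length (path (par j))) = M * a"
    by (simp add: a_def Suc_diff_le flip: power_Suc) (metis Suc_diff_Suc Suc_le_eq)
  have a: "a \<ge> 1" using M by (simp add: a_def)
  have "M * a \<le> int (edge_mult T j (par j)) * (M * a)"
    using edge_mult_parent_pos[OF j] a M mult_right_mono[of 1 "int (edge_mult T j (par j))" "M * a"] by simp
  also have "\<dots> \<le> (\<Sum>k\<in>verts T. int (edge_mult T j k) * M ^ (L - length (path k)))"
    unfolding par[symmetric] using finite_verts parent_in_verts[OF j] M
    by (intro member_le_sum) auto
  finally have 1: "M * a \<le> (\<Sum>k\<in>verts T. int (edge_mult T j k) * M ^ (L - length (path k)))" .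
  have "laplacian T h j = (\<Sum>k\<in>verts T. int (edge_mult T j k) * (a - M ^ (L - length (path k))))"
    by (simp add: laplacian_def h_def a_def)
  also have "\<dots> = int (deg T j) * a - (\<Sum>k\<in>verts T. int (edge_mult T j k) * M ^ (L - length (path k)))"
    by (simp add: deg_def right_diff_distrib sum_subtractf sum_distrib_right)
  also have "\<dots> \<le> (int (deg T j) - M) * a"
    using 1 by (simp add: algebra_simps)
  also have "\<dots> \<le> (-1) * a"
    using deg_less[OF jv] a by (intro mult_right_mono) auto
  also have "\<dots> \<le> -1" using a by simp
  finally show "laplacian T h j \<le> -1" .
qed

text \<open>Weighting grains by the superharmonic \<open>h\<close> gives a nonnegative integer
  potential. Toppling \<open>i\<close> changes it by at most \<open>laplacian T h i\<close>, so it
  strictly decreases.\<close>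

lemma topples_to_stable: "\<exists>v. (topples_to T s)\<^sup>*\<^sup>* u v \<and> stable T s v"
proof -
  obtain h :: "'v \<Rightarrow> int" where h: "\<And>j. j \<in> verts T \<Longrightarrow> h j \<ge> 0"
    and lap: "\<And>j. j \<in> nonsink T s \<Longrightarrow> laplacian T h j \<le> -1"
    using superharmonic_function by blast
  define pot where "pot u = (\<Sum>j\<in>nonsink T s. int (u j) * h j)" for u
  have pot_nonneg: "pot u \<ge> 0" for u
    unfolding pot_def using h nonsink_in_verts by (intro sum_nonneg) auto
  have decr: "pot v < pot u" if uv: "topples_to T s u v" for u v
  proof -
    obtain i where i: "i \<in> nonsink T s" "\<not> stable_at T u i" "v = topple T s i u"
      using uv unfolding topples_to_def by blast
    have "pot v = (\<Sum>j\<in>nonsink T s. int (u j) * h j + int (edge_mult T i j) * h j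
        - (if j = i then int (deg T i) * h i else 0))"
      unfolding pot_def using i by (intro sum.cong) (auto simp: int_topple algebra_simps)
    also have "\<dots> = pot u + (\<Sum>j\<in>nonsink T s. int (edge_mult T i j) * h j) - int (deg T i) * h i"
      using i finite_nonsink by (simp add: sum.distrib sum_subtractf pot_def)
    \<comment> \<open>Grains lost to the sink are counted too; this can only increase the bound
      because \<open>h s\<close> is nonnegative.\<close>
    also have "\<dots> \<le> pot u + (\<Sum>j\<in>verts T. int (edge_mult T i j) * h j) - int (deg T i) * h i"
      using h finite_verts
      by (intro diff_right_mono add_left_mono sum_mono2) (auto simp: nonsink_def)
    also have "\<dots> = pot u + laplacian T h i"
      by (simp add: laplacian_def deg_def right_diff_distrib sum_subtractf sum_distrib_right)
    finally show ?thesis using lap[OF i(1)] by simp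
  qed
  show ?thesis
  proof (induction "nat (pot u)" arbitrary: u rule: less_induct)
    case less
    show ?case
    proof (cases "stable T s u")
      case False
      then obtain v where v: "topples_to T s u v" by (auto simp: stable_def topples_to_def)
      then have "nat (pot v) < nat (pot u)" using decr[OF v] pot_nonneg[of v] by simp
      from less[OF this] v show ?thesis by (meson converse_rtranclp_into_rtranclp)
    qed blast
  qed
qed

lemma
  shows topples_to_stabilization: "(topples_to T s)\<^sup>*\<^sup>* u (stabilization T s u)"
    and stable_stabilization: "stable T s (stabilization T s u)"
  using topples_to_stable[of u] stabilization_eqI by metis+

lemma stabilization_topples_to:
  "(topples_to T s)\<^sup>*\<^sup>* u v \<Longrightarrow> stabilization T s u = stabilization T s v"
  using topples_to_stabilization stable_stabilization stabilization_eqI rtranclp_trans by metis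

lemma stabilization_add:
  "stabilization T s (\<lambda>i. stabilization T s u i + w i) = stabilization T s (\<lambda>i. u i + w i)"
  using stabilization_topples_to[OF topples_to_add[OF topples_to_stabilization]] by simp

lemma stabilization_equiv: "toppling_equiv T s u (stabilization T s u)"
  using topples_to_toppling_equiv[OF finite_verts topples_to_stabilization] .

lemma stabilization_configs: "u \<in> configs T s \<Longrightarrow> stabilization T s u \<in> configs T s"
  using topples_to_configs[OF topples_to_stabilization] .

section \<open>Recurrent configurations on a thick tree\<close>

text \<open>Stable heights are at most the degree minus one, so \<open>c\<close> dominates every
  stable configuration. From any \<open>v\<close>, stabilizing and then adding the missing grains
  \<open>w\<close> leads to \<open>c\<close>.\<close>

lemma recurrent_stabilization:
  assumes "c \<in> configs T s" and "\<forall>i\<in>nonsink T s. deg T i \<le> c i + 1"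
  shows "recurrent T s (stabilization T s c)"
  unfolding recurrent_def
proof (intro conjI ballI)
  show "stabilization T s c \<in> configs T s" by (rule stabilization_configs[OF assms(1)])
next
  fix v assume v: "v \<in> configs T s"
  define w where "w = (\<lambda>i. c i - stabilization T s v i)"
  have "stabilization T s v i \<le> c i" for i
  proof (cases "i \<in> nonsink T s")
    case True
    then have "stabilization T s v i < deg T i"
      using stable_stabilization by (simp add: stable_def stable_at_def)
    then show ?thesis using assms(2) True by fastforce
  next
    case False
    then show ?thesis using stabilization_configs[OF v] by (simp add: configs_def)
  qed
  then have "(\<lambda>i. stabilization T s v i + w i) = c" by (simp add: w_def)
  then have "sandpile_add T s v w = stabilization T s c"
    using stabilization_add[of v w] by (simp add: sandpile_add_def add.commute)
  moreover have "w \<in> configs T s" using assms(1) by (simp add: w_def configs_def)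
  ultimately show "\<exists>w\<in>configs T s. sandpile_add T s v w = stabilization T s c" by blast
qed

lemma edge_mult_sum_subtree:
  assumes "j \<in> nonsink T s" and "i \<in> subtree j"
  shows "(\<Sum>k\<in>subtree j. edge_mult T i k) + (if i = j then edge_mult T j (par j) else 0)
    = deg T i"
proof -
  have "deg T i = (\<Sum>k\<in>subtree j. edge_mult T i k) + (\<Sum>k\<in>verts T - subtree j. edge_mult T i k)"
    unfolding deg_def using finite_verts
    by (subst sum.subset_diff[of "subtree j"]) (auto simp: subtree_iff)
  also have "(\<Sum>k\<in>verts T - subtree j. edge_mult T i k) =
      (\<Sum>k\<in>verts T - subtree j. if k = par j then if i = j then edge_mult T j (par j) else 0 else 0)"
    using edge_leaving_subtree[OF assms] by (intro sum.cong) auto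
  also have "\<dots> = (if i = j then edge_mult T j (par j) else 0)"
    using finite_verts parent_in_verts[OF assms(1)] parent_notin_subtree[OF assms(1)]
    by simp
  finally show ?thesis by simp
qed

lemma recurrent_bounds:
  assumes "recurrent T s w" and "j \<in> nonsink T s"
  shows "w j < deg T j" and "deg T j \<le> w j + edge_mult T j (par j)"
proof -
  \<comment> \<open>Recurrence is tested against a configuration that is unstable everywhere, so
    that \<open>w\<close> is reached from a starting point free of forbidden
    subconfigurations.\<close>
  define v where "v = (\<lambda>i. if i \<in> nonsink T s then deg T i else 0)"
  have "v \<in> configs T s" by (simp add: v_def configs_def)
  then obtain w' where w: "w = stabilization T s (\<lambda>i. v i + w' i)"
    using assms(1) unfolding recurrent_def sandpile_add_def by metis
  have less: "w i < deg T i" if "i \<in> nonsink T s" for i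
    using stable_stabilization that by (simp add: w stable_def stable_at_def)
  show "w j < deg T j" by (rule less[OF assms(2)])
  note jv = nonsink_in_verts[OF assms(2)]
  have "\<exists>i\<in>subtree j. (\<Sum>k\<in>subtree j. edge_mult T i k) \<le> w i"
    unfolding w
  proof (rule topples_to_no_forbidden_subconfig[OF finite_verts topples_to_stabilization])
    show "\<forall>i\<in>nonsink T s. deg T i \<le> v i + w' i" by (simp add: v_def)
  qed (use subtree_subset_nonsink[OF assms(2)] self_in_subtree[OF jv] in auto)
  then obtain i where i: "i \<in> subtree j" "(\<Sum>k\<in>subtree j. edge_mult T i k) \<le> w i" by blast
  \<comment> \<open>For a witness \<open>i\<close> other than \<open>j\<close>, all edges at
    \<open>i\<close> stay in the subtree and the inequality would contradict stability at
    \<open>i\<close>. Hence the witness is \<open>j\<close>, which misses only its edges to the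
    parent.\<close>
  show "deg T j \<le> w j + edge_mult T j (par j)"
    using edge_mult_sum_subtree[OF assms(2) i(1)] i less[of i] subtree_subset_nonsink[OF assms(2)]
    by (cases "i = j") auto
qed

text \<open>If the toppling vector \<open>x\<close> relating the two configurations is not constant, take \<open>j\<close> farthest
  from the sink with \<open>x j \<noteq> x (par j)\<close>: only the edges from \<open>j\<close> to its parent contribute to
  \<open>laplacian T x j\<close>, a nonzero multiple of their number, contradicting \<open>recurrent_bounds\<close>.\<close>

lemma recurrent_unique:
  assumes "recurrent T s v" and "recurrent T s w" and "toppling_equiv T s v w"
  shows "v = w"
proof
  obtain x where x: "\<And>j. j \<in> nonsink T s \<Longrightarrow> int (w j) = int (v j) + laplacian T x j"
    using assms(3) by (auto simp: toppling_equiv_def)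
  have const: "x j = x (par j)" if "j \<in> nonsink T s" for j
  proof (rule ccontr)
    assume "x j \<noteq> x (par j)"
    define J where "J = {j \<in> nonsink T s. x j \<noteq> x (par j)}"
    have "finite J" "J \<noteq> {}"
      using finite_nonsink that \<open>x j \<noteq> x (par j)\<close> by (auto simp: J_def)
    then have "Max ((\<lambda>j. length (path j)) ` J) \<in> (\<lambda>j. length (path j)) ` J" by simp
    then obtain m where mJ: "m \<in> J" and "Max ((\<lambda>j. length (path j)) ` J) = length (path m)"
      by blast
    with \<open>finite J\<close> have max: "length (path k) \<le> length (path m)" if "k \<in> J" for k
      using that Max_ge[of "(\<lambda>j. length (path j)) ` J"] by fastforce
    have m: "m \<in> nonsink T s" "x m \<noteq> x (par m)" using mJ by (auto simp: J_def)
    \<comment> \<open>Such a \<open>k\<close> is \<open>m\<close> itself or a child of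
      \<open>m\<close>; a child is farther from the sink, hence outside \<open>J\<close> by
      maximality.\<close>
    have "x k = x m" if "k \<in> verts T" "k \<noteq> par m" "edge_mult T m k > 0" for k
    proof (cases "k = m")
      case False
      then have "adjacent T m k" using that by (simp add: adjacent_iff_edge_mult)
      then have k: "k \<in> nonsink T s" "par k = m"
        using adjacent_cases[OF _ m(1) that(1)] that(2) by metis+
      then have "k \<notin> J" using max[of k] arg_cong[OF path_parent[OF k(1)], of length] by auto
      then show ?thesis using k by (simp add: J_def)
    qed simp
    then have "laplacian T x m =
        (\<Sum>k\<in>verts T. if k = par m then int (edge_mult T m (par m)) * (x (par m) - x m) else 0)"
      unfolding laplacian_def by (intro sum.cong) auto
    also have "\<dots> = int (edge_mult T m (par m)) * (x (par m) - x m)"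
      using finite_verts parent_in_verts[OF m(1)] by simp
    finally have lap: "int (w m) - int (v m) = int (edge_mult T m (par m)) * (x (par m) - x m)"
      using x[OF m(1)] by simp
    \<comment> \<open>Both heights lie in the same window of length
      \<open>edge_mult T m (par m)\<close> below the degree.\<close>
    have "\<bar>int (w m) - int (v m)\<bar> < int (edge_mult T m (par m))"
      using recurrent_bounds[OF assms(1) m(1)] recurrent_bounds[OF assms(2) m(1)] by linarith
    moreover have "int (edge_mult T m (par m)) * 1 \<le>
        int (edge_mult T m (par m)) * \<bar>x (par m) - x m\<bar>"
      using m(2) by (intro mult_left_mono) auto
    ultimately show False unfolding lap abs_mult by simp
  qed
  fix j
  show "v j = w j"
  proof (cases "j \<in> nonsink T s")
    case False
    then show ?thesis using assms by (simp add: recurrent_def configs_def)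
  next
    case True
    \<comment> \<open>Every neighbour is a parent or a child, so agreement with parents makes
      \<open>x\<close> constant along all edges.\<close>
    have "x k = x j" if "k \<in> verts T" "edge_mult T j k > 0" for k
    proof (cases "k = j")
      case False
      then have "adjacent T j k" using that by (simp add: adjacent_iff_edge_mult)
      then show ?thesis
        using True that(1) by (cases rule: adjacent_cases) (use const True in auto)
    qed simp
    then have "laplacian T x j = 0"
      unfolding laplacian_def by (intro sum.neutral) auto
    then show ?thesis using x[OF True] by simp
  qed
qed

text \<open>Since \<open>c\<close> lies in the class of zero and is large, \<open>c + v\<close>
  stabilizes to a recurrent configuration in the class of \<open>v\<close>, which is
  \<open>v\<close> itself when \<open>v\<close> is recurrent. The statement exposes \<open>c\<close>
  so that it can replace the identity in later stabilizations.\<close>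

lemma sandpile_group_one:
  obtains c where "c \<in> configs T s" and "\<forall>i\<in>nonsink T s. deg T i \<le> c i"
    and "toppling_equiv T s (\<lambda>_. 0) c"
    and "\<one>\<^bsub>sandpile_group T s\<^esub> = stabilization T s c"
proof -
  obtain h :: "'v \<Rightarrow> int" where lap: "\<And>j. j \<in> nonsink T s \<Longrightarrow> laplacian T h j \<le> -1"
    using superharmonic_function by blast
  define N where "N = (\<Sum>j\<in>verts T. int (deg T j))"
  have deg_le: "int (deg T j) \<le> N" if "j \<in> verts T" for j
    unfolding N_def using that finite_verts by (intro member_le_sum) auto
  have N: "N \<ge> 0" by (simp add: N_def sum_nonneg)
  \<comment> \<open>Since \<open>laplacian T h\<close> is at most -1, scaling by \<open>- N\<close>
    yields entries of at least \<open>N\<close>, which bounds every degree; in particular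
    \<open>nat\<close> loses nothing.\<close>
  define c where "c = (\<lambda>i. if i \<in> nonsink T s then nat (- N * laplacian T h i) else 0)"
  have c_ge: "N \<le> - N * laplacian T h i" if "i \<in> nonsink T s" for i
    using mult_left_mono[OF lap[OF that] N] by simp
  have c: "c \<in> configs T s" by (simp add: c_def configs_def)
  have c_deg: "\<forall>i\<in>nonsink T s. deg T i \<le> c i"
    using c_ge deg_le nonsink_in_verts by (force simp: c_def)
  have equiv: "toppling_equiv T s (\<lambda>_. 0) c"
    unfolding toppling_equiv_def
  proof (intro exI ballI)
    fix j assume j: "j \<in> nonsink T s"
    show "int (c j) = int 0 + laplacian T (\<lambda>k. (- N) * h k) j"
      unfolding laplacian_scale using j c_ge[OF j] N by (simp add: c_def)
  qed
  let ?e = "stabilization T s c"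
  have e: "recurrent T s ?e"
    by (rule recurrent_stabilization) (use c c_deg in \<open>auto intro: le_SucI\<close>)
  have left: "sandpile_add T s ?e v = v" if "recurrent T s v" for v
  proof (rule recurrent_unique[OF _ that])
    have eq: "sandpile_add T s ?e v = stabilization T s (\<lambda>i. c i + v i)"
      by (simp add: sandpile_add_def stabilization_add)
    show "recurrent T s (sandpile_add T s ?e v)"
      unfolding eq
      by (rule recurrent_stabilization)
        (use c c_deg that in \<open>auto simp: configs_def recurrent_def intro: le_SucI trans_le_add1\<close>)
    have "toppling_equiv T s v (\<lambda>i. c i + v i)"
      using toppling_equiv_add[OF equiv, of v] by simp
    then show "toppling_equiv T s (sandpile_add T s ?e v) v"
      unfolding eq using stabilization_equiv toppling_equiv_trans toppling_equiv_sym by metis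
  qed
  have commute: "sandpile_add T s v w = sandpile_add T s w v" for v w
    by (simp add: sandpile_add_def add.commute)
  have "\<one>\<^bsub>sandpile_group T s\<^esub> = ?e"
    unfolding sandpile_group_def monoid.simps
  proof (rule the_equality)
    show "recurrent T s ?e \<and>
        (\<forall>v. recurrent T s v \<longrightarrow> sandpile_add T s ?e v = v \<and> sandpile_add T s v ?e = v)"
      using e left commute by simp
  next
    fix e' assume "recurrent T s e' \<and>
        (\<forall>v. recurrent T s v \<longrightarrow> sandpile_add T s e' v = v \<and> sandpile_add T s v e' = v)"
    then show "e' = ?e" using e left by metis
  qed
  with c c_deg equiv show thesis by (rule that)
qed

text \<open>This is a discrete divergence theorem: flow along inner edges cancels, and the boundary
  of the subtree consists of the edges from \<open>j\<close> to its parent.\<close>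

lemma sum_laplacian_subtree:
  assumes "j \<in> nonsink T s"
  shows "(\<Sum>i\<in>subtree j. laplacian T x i) = int (edge_mult T j (par j)) * (x (par j) - x j)"
proof -
  let ?f = "\<lambda>i k. int (edge_mult T i k) * (x k - x i)"
  have jv: "j \<in> verts T" by (rule nonsink_in_verts[OF assms])
  have "(\<Sum>i\<in>subtree j. laplacian T x i) =
      (\<Sum>i\<in>subtree j. (\<Sum>k\<in>subtree j. ?f i k) + (\<Sum>k\<in>verts T - subtree j. ?f i k))"
    unfolding laplacian_def using finite_verts
    by (intro sum.cong refl, subst sum.subset_diff[of "subtree j"]) (auto simp: subtree_iff)
  also have "\<dots> = (\<Sum>i\<in>subtree j. \<Sum>k\<in>subtree j. ?f i k)
      + (\<Sum>i\<in>subtree j. \<Sum>k\<in>verts T - subtree j. ?f i k)"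
    by (rule sum.distrib)
  \<comment> \<open>The summand is antisymmetric in \<open>i\<close> and \<open>k\<close>, so the
    double sum equals its own negative.\<close>
  also have "(\<Sum>i\<in>subtree j. \<Sum>k\<in>subtree j. ?f i k) = 0"
  proof -
    have "(\<Sum>i\<in>subtree j. \<Sum>k\<in>subtree j. ?f i k) = (\<Sum>k\<in>subtree j. \<Sum>i\<in>subtree j. ?f i k)"
      by (rule sum.swap)
    also have "\<dots> = (\<Sum>k\<in>subtree j. \<Sum>i\<in>subtree j. - ?f k i)"
      by (intro sum.cong refl) (simp add: edge_mult_commute algebra_simps)
    also have "\<dots> = - (\<Sum>k\<in>subtree j. \<Sum>i\<in>subtree j. ?f k i)"
      by (simp only: sum_negf)
    finally show ?thesis by simp
  qed
  also have "(\<Sum>i\<in>subtree j. \<Sum>k\<in>verts T - subtree j. ?f i k) =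
      (\<Sum>i\<in>subtree j. if i = j then ?f j (par j) else 0)"
  proof (rule sum.cong[OF refl])
    fix i assume i: "i \<in> subtree j"
    have "(\<Sum>k\<in>verts T - subtree j. ?f i k) =
        (\<Sum>k\<in>verts T - subtree j. if k = par j then if i = j then ?f j (par j) else 0 else 0)"
      using edge_leaving_subtree[OF assms i] by (intro sum.cong refl) auto
    also have "\<dots> = (if i = j then ?f j (par j) else 0)"
      using finite_verts parent_in_verts[OF assms] parent_notin_subtree[OF assms]
      by simp
    finally show "(\<Sum>k\<in>verts T - subtree j. ?f i k) = (if i = j then ?f j (par j) else 0)" .
  qed
  also have "\<dots> = ?f j (par j)"
    using finite_subtree self_in_subtree[OF jv] by simp
  finally show ?thesis by simp
qed

lemma recursive_formulas_recurrent:
  assumes "recurrent T s w" and "toppling_equiv T s u w"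
  shows "recursive_formulas T s u w"
  unfolding recursive_formulas_def
proof
  fix j assume j: "j \<in> nonsink T s"
  let ?e = "int (edge_mult T j (par j))"
  obtain x where x: "\<And>j. j \<in> nonsink T s \<Longrightarrow> int (w j) = int (u j) + laplacian T x j"
    using assms(2) by (auto simp: toppling_equiv_def)
  define m where "m = x (par j) - x j"
  have jv: "j \<in> verts T" by (rule nonsink_in_verts[OF j])
  have above: "{i. above T s i j} = subtree j - {j}"
    by (auto simp: above_def subtree_def)
  have "(\<Sum>i\<in>subtree j. int (w i) - int (u i)) = (\<Sum>i\<in>subtree j. laplacian T x i)"
    using x subtree_subset_nonsink[OF j] by (intro sum.cong) auto
  moreover have "excess_above T s u w j = - (\<Sum>i\<in>subtree j - {j}. int (w i) - int (u i))"
    by (simp add: excess_above_def above flip: sum_negf)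
  ultimately have w: "int (w j) = int (u j) + excess_above T s u w j + ?e * m"
    using sum_laplacian_subtree[OF j, of x]
      sum.remove[OF finite_subtree self_in_subtree[OF jv], of "\<lambda>i. int (w i) - int (u i)"]
    by (simp add: m_def)
  note bounds = recurrent_bounds[OF assms(1) j]
  show "int (w j) =
      (if leaf T s j \<and> edge_mult T j j = 0
       then int (u j) - \<lfloor>real (u j) / real (edge_mult T j (par j))\<rfloor> * ?e
       else int (u j) + lambda_coeff T s u w j * ?e + excess_above T s u w j)"
  proof (cases "leaf T s j \<and> edge_mult T j j = 0")
    case True
    then have sub: "subtree j = {j}" using leaf_subtree by blast
    then have "excess_above T s u w j = 0" by (simp add: excess_above_def above)
    \<comment> \<open>Without loops and with nothing above \<open>j\<close>, all edges at
      \<open>j\<close> go to the parent. The bounds then make \<open>w j\<close> the remainder of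
      \<open>u j\<close> modulo their number.\<close>
    moreover have "deg T j = edge_mult T j (par j)"
      using edge_mult_sum_subtree[OF j self_in_subtree[OF jv]] True sub by simp
    ultimately have "int (u j) div ?e = - m"
      using w bounds by (intro int_div_pos_eq[of _ _ _ "int (w j)"]) (auto simp: algebra_simps)
    then have "\<lfloor>real (u j) / real (edge_mult T j (par j))\<rfloor> = - m"
      using floor_divide_of_int_eq[of "int (u j)" ?e, where ?'a = real] by simp
    then show ?thesis using True w \<open>excess_above T s u w j = 0\<close> by simp
  next
    case False
    \<comment> \<open>The remainder of this division is \<open>deg T j - 1 - w j\<close>. The two
      bounds on \<open>w j\<close> say exactly that it is nonnegative and less than the divisor,
      which accounts for the -1 in \<open>lambda_coeff\<close>.\<close>
    have "(int (deg T j) - int (u j) - excess_above T s u w j - 1) div ?e = m"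
      using w bounds
      by (intro int_div_pos_eq[of _ _ _ "int (deg T j) - 1 - int (w j)"]) auto
    then have "lambda_coeff T s u w j = m"
      unfolding lambda_coeff_def
      using floor_divide_of_int_eq[of "int (deg T j) - int (u j) - excess_above T s u w j - 1" ?e,
          where ?'a = real]
      by simp
    then show ?thesis by (subst if_not_P[OF False]) (simp add: w)
  qed
qed

end

theorem corollary3p5:
  fixes T :: "'v multigraph" and s :: 'v and u :: "'v \<Rightarrow> nat"
  assumes "thick_tree_with_loops T"
    and "s \<in> verts T"
    and "u \<in> configs T s"
  shows "(let w = stabilization T s (\<lambda>i. u i + \<one>\<^bsub>sandpile_group T s\<^esub> i)
          in recurrent T s w \<and> recursive_formulas T s u w)
         \<and> (recurrent T s (stabilization T s u) \<longrightarrow>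
            recursive_formulas T s u (stabilization T s u))"
proof -
  interpret thick_tree T s by standard (fact assms)+
  obtain c where c: "c \<in> configs T s" "\<forall>i\<in>nonsink T s. deg T i \<le> c i"
      "toppling_equiv T s (\<lambda>_. 0) c"
    and one: "\<one>\<^bsub>sandpile_group T s\<^esub> = stabilization T s c"
    by (rule sandpile_group_one)
  define w where "w = stabilization T s (\<lambda>i. u i + \<one>\<^bsub>sandpile_group T s\<^esub> i)"
  \<comment> \<open>Stabilizing \<open>c\<close> beforehand is immaterial. The sum
    \<open>c + u\<close> has at least the degree at every non-sink vertex, so its stabilization is
    recurrent for arbitrary \<open>u\<close>.\<close>
  have w: "w = stabilization T s (\<lambda>i. c i + u i)"
    using stabilization_add[of c u] by (simp add: w_def one add.commute)
  have "recurrent T s w"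
    unfolding w
    by (rule recurrent_stabilization)
      (use c assms(3) in \<open>auto simp: configs_def intro: le_SucI trans_le_add1\<close>)
  moreover have "toppling_equiv T s u w"
    using toppling_equiv_add[OF c(3), of u] stabilization_equiv toppling_equiv_trans
    unfolding w by fastforce
  ultimately show ?thesis
    using recursive_formulas_recurrent stabilization_equiv unfolding w_def Let_def by blast
qed

end
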